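(* Let $A$ and $B$ be additively idempotent semirings having no multiplicatively idempotent zero divisors. Let $(\Phi,D)$ and $(\Psi,D)$ be the valuation algebras induced by $A$ and $B$ respectively (over the same finite set $r$ of variables with the same frames, $D=\mathcal P(r)$), and let $h:(\Phi,D)\to(\Psi,D)$ be a valuation algebra isomorphism. Then the map $f:A\to B$, $f(a)=h(\zeta^{(a)})(\epsilon)$, where $\zeta^{(a)}:\Omega_\emptyset=\{\epsilon\}\to A$ is the valuation with empty domain and $\zeta^{(a)}(\epsilon)=a$, is a semiring isomorphism.
   Context: Semirings: a semiring $\langle A,+,\times\rangle$ has two commutative and associative binary operations with $\times$ distributing over $+$, a zero element $0$ ($0+a=a$ and $0\times a=0$ for all $a$) and a unit element $1$ ($1\times a=a$ for all $a$). It is additively idempotent if $a+a=a$ for all $a$. It has no multiplicatively idempotent zero divisors if there is no $a\neq0$ with $a\times a=a$ such that $a\times b=0$ for some $b\neq 0$. A semiring homomorphism preserves $+$, $\times$, $0$ and $1$; a semiring isomorphism is a bijective semiring homomorphism. Variables and configurations: $r$ is a non-empty finite set of variables; each variable $X\in r$ has a finite set $\Omega_X$ of values (its frame), and at least one frame has at least two elements. $D=\mathcal P(r)$. For $s\subseteq r$, $\Omega_s=\prod_{X\in s}\Omega_X$, with $\Omega_\emptyset=\{\epsilon\}$ a singleton. For $\mathbf x\in\Omega_s$ and $t\subseteq s$, $\mathbf x^{\downarrow t}\in\Omega_t$ denotes the projection (restriction) of $\mathbf x$ to $t$. Induced valuation algebra: given a semiring $A$, a valuation with domain $d(\phi)=s\subseteq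 r$ is a function $\phi:\Omega_s\to A$ (the domain $s$ is part of the data). $\Phi$ is the set of all valuations for all $s\subseteq r$, and $\Phi_s$ the set of those with domain $s$. Combination: $d(\phi\otimes\psi)=d(\phi)\cup d(\psi)$ and $(\phi\otimes\psi)(\mathbf x)=\phi(\mathbf x^{\downarrow d(\phi)})\times\psi(\mathbf x^{\downarrow d(\psi)})$. Marginalization, for $t\subseteq d(\phi)=s$: $\phi^{\downarrow t}\in\Phi_t$ with $\phi^{\downarrow t}(\mathbf x)=\sum_{\mathbf z\in\Omega_s,\ \mathbf z^{\downarrow t}=\mathbf x}\phi(\mathbf z)$. Neutral elements: $e_s\in\Phi_s$ is the constant function $1$. The pair $(\Phi,D)$ with these operations is the valuation algebra induced by $A$. A map $h:\Phi\to\Psi$ is a homomorphism of valuation algebras $(\Phi,D)\to(\Psi,D)$ if $h(\phi_1\otimes\phi_2)=h(\phi_1)\otimes h(\phi_2)$ for all $\phi_1,\phi_2$; $h(\phi^{\downarrow x})=h(\phi)^{\downarrow x}$ whenever $x\subseteq d(\phi)$ (this includes that $x\subseteq d(h(\phi))$, so that the right-hand side is defined); and $h(e_x)=e_x$ for all $x\in D$. An isomorphism is a bijective homomorphism. Such homomorphisms preserve domains, $d(h(\phi))=d(\phi)$, so $f$ is well defined. *)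

theory Defs
  imports Main "HOL-Library.FuncSet"
begin

text \<open>
  Semirings are commutative with zero and unit, and \<open>0 = 1\<close> is not excluded. The library class
  \<open>comm_semiring_1\<close> includes \<open>0 \<noteq> 1\<close>, so the sort
  \<open>{comm_semiring_0, comm_monoid_mult}\<close> is used instead.
\<close>

definition additively_idempotent :: "'a::{comm_semiring_0, comm_monoid_mult} itself \<Rightarrow> bool" where
  "additively_idempotent _ \<longleftrightarrow> (\<forall>a::'a. a + a = a)"

definition no_mult_idempotent_zero_divisors ::
    "'a::{comm_semiring_0, comm_monoid_mult} itself \<Rightarrow> bool" where
  "no_mult_idempotent_zero_divisors _ \<longleftrightarrow>
     \<not> (\<exists>a::'a. a \<noteq> 0 \<and> a * a = a \<and> (\<exists>b. b \<noteq> 0 \<and> a * b = 0))"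

definition semiring_hom ::
    "('a::{comm_semiring_0, comm_monoid_mult} \<Rightarrow> 'b::{comm_semiring_0, comm_monoid_mult}) \<Rightarrow> bool"
  where
  "semiring_hom f \<longleftrightarrow>
     (\<forall>a b. f (a + b) = f a + f b) \<and> (\<forall>a b. f (a * b) = f a * f b) \<and> f 0 = 0 \<and> f 1 = 1"

definition semiring_iso ::
    "('a::{comm_semiring_0, comm_monoid_mult} \<Rightarrow> 'b::{comm_semiring_0, comm_monoid_mult}) \<Rightarrow> bool"
  where
  "semiring_iso f \<longleftrightarrow> semiring_hom f \<and> bij f"

text \<open>
  The frame of a variable \<open>X\<close> is \<open>\<Omega> X\<close>; all frames live in one common type \<open>'x\<close>.
  Configurations are extensional functions, so that projection to \<open>t\<close> is \<open>restrict x t\<close>.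
\<close>

definition configs :: "('v \<Rightarrow> 'x set) \<Rightarrow> 'v set \<Rightarrow> ('v \<Rightarrow> 'x) set" where
  "configs \<Omega> s = (\<Pi>\<^sub>E X\<in>s. \<Omega> X)"

definition empty_config :: "'v \<Rightarrow> 'x" where
  "empty_config = (\<lambda>_. undefined)"

lemma configs_empty: "configs \<Omega> {} = {empty_config}"
  by (simp add: configs_def empty_config_def)

text \<open>
  A valuation is a pair of its domain \<open>s\<close> and a function on \<open>configs \<Omega> s\<close>, extended by
  \<open>undefined\<close> so that equality of pairs is equality of valuations.
\<close>

type_synonym ('v, 'x, 'a) valuation = "'v set \<times> (('v \<Rightarrow> 'x) \<Rightarrow> 'a)"

definition valuations :: "'v set \<Rightarrow> ('v \<Rightarrow> 'x set) \<Rightarrow> ('v, 'x, 'a) valuation set" where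
  "valuations r \<Omega> = (SIGMA s:Pow r. configs \<Omega> s \<rightarrow>\<^sub>E UNIV)"

abbreviation val_dom :: "('v, 'x, 'a) valuation \<Rightarrow> 'v set" where
  "val_dom \<equiv> fst"

abbreviation val_fun :: "('v, 'x, 'a) valuation \<Rightarrow> ('v \<Rightarrow> 'x) \<Rightarrow> 'a" where
  "val_fun \<equiv> snd"

definition combine :: "('v \<Rightarrow> 'x set) \<Rightarrow>
    ('v, 'x, 'a::{comm_semiring_0, comm_monoid_mult}) valuation \<Rightarrow>
    ('v, 'x, 'a) valuation \<Rightarrow> ('v, 'x, 'a) valuation" where
  "combine \<Omega> \<phi> \<psi> =
     (val_dom \<phi> \<union> val_dom \<psi>,
      \<lambda>x \<in> configs \<Omega> (val_dom \<phi> \<union> val_dom \<psi>).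
        val_fun \<phi> (restrict x (val_dom \<phi>)) * val_fun \<psi> (restrict x (val_dom \<psi>)))"

text \<open>Meaningful only for \<open>t \<subseteq> val_dom \<phi>\<close>.\<close>

definition marginalize :: "('v \<Rightarrow> 'x set) \<Rightarrow>
    ('v, 'x, 'a::{comm_semiring_0, comm_monoid_mult}) valuation \<Rightarrow>
    'v set \<Rightarrow> ('v, 'x, 'a) valuation" where
  "marginalize \<Omega> \<phi> t =
     (t, \<lambda>x \<in> configs \<Omega> t.
           \<Sum>z \<in> {z \<in> configs \<Omega> (val_dom \<phi>). restrict z t = x}. val_fun \<phi> z)"

definition const_val :: "('v \<Rightarrow> 'x set) \<Rightarrow> 'v set \<Rightarrow> 'a \<Rightarrow> ('v, 'x, 'a) valuation" where
  "const_val \<Omega> s a = (s, \<lambda>x \<in> configs \<Omega> s. a)"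

definition neutral_val :: "('v \<Rightarrow> 'x set) \<Rightarrow> 'v set \<Rightarrow>
    ('v, 'x, 'a::{comm_semiring_0, comm_monoid_mult}) valuation" where
  "neutral_val \<Omega> s = const_val \<Omega> s 1"

definition scalar_val :: "('v \<Rightarrow> 'x set) \<Rightarrow> 'a \<Rightarrow> ('v, 'x, 'a) valuation" where
  "scalar_val \<Omega> a = const_val \<Omega> {} a"

definition valuation_algebra_hom :: "'v set \<Rightarrow> ('v \<Rightarrow> 'x set) \<Rightarrow>
    (('v, 'x, 'a::{comm_semiring_0, comm_monoid_mult}) valuation \<Rightarrow>
     ('v, 'x, 'b::{comm_semiring_0, comm_monoid_mult}) valuation) \<Rightarrow> bool" where
  "valuation_algebra_hom r \<Omega> h \<longleftrightarrow>
     h \<in> valuations r \<Omega> \<rightarrow> valuations r \<Omega> \<and>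
     (\<forall>\<phi> \<in> valuations r \<Omega>. \<forall>\<psi> \<in> valuations r \<Omega>.
        h (combine \<Omega> \<phi> \<psi>) = combine \<Omega> (h \<phi>) (h \<psi>)) \<and>
     (\<forall>\<phi> \<in> valuations r \<Omega>. \<forall>t. t \<subseteq> val_dom \<phi> \<longrightarrow>
        t \<subseteq> val_dom (h \<phi>) \<and> h (marginalize \<Omega> \<phi> t) = marginalize \<Omega> (h \<phi>) t) \<and>
     (\<forall>s. s \<subseteq> r \<longrightarrow> h (neutral_val \<Omega> s) = neutral_val \<Omega> s)"

definition valuation_algebra_iso :: "'v set \<Rightarrow> ('v \<Rightarrow> 'x set) \<Rightarrow>
    (('v, 'x, 'a::{comm_semiring_0, comm_monoid_mult}) valuation \<Rightarrow>
     ('v, 'x, 'b::{comm_semiring_0, comm_monoid_mult}) valuation) \<Rightarrow> bool" where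
  "valuation_algebra_iso r \<Omega> h \<longleftrightarrow>
     valuation_algebra_hom r \<Omega> h \<and> bij_betw h (valuations r \<Omega>) (valuations r \<Omega>)"

end

theory Submission
  imports Defs
begin

text \<open>
  On a domain \<open>s\<close> with at least two configurations, the indicators \<open>\<delta>\<^sub>i\<close> of single
  configurations are pairwise orthogonal idempotents of total mass \<open>1\<close>, hence so are their images
  \<open>u\<^sub>i\<close>. As \<open>B\<close> has no multiplicatively idempotent zero divisors, the supports of the \<open>u\<^sub>i\<close> are
  pairwise disjoint; they are non-empty by injectivity, so by counting \<open>u\<^sub>i\<close> is the indicator of a
  configuration \<open>\<sigma> i\<close>, with \<open>\<sigma>\<close> a permutation. Multiplying by \<open>\<delta>\<^sub>i\<close> then shows that \<open>h\<close> acts on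
  valuations over \<open>s\<close> as \<open>f\<close> on values, up to \<open>\<sigma>\<close>, and marginalizing to the empty domain turns
  sums into sums.
\<close>

section \<open>Additivity from functions on a finite set\<close>

text \<open>\<open>C\<close> stands for the configurations over one variable, \<open>H\<close> for
  the action of \<open>h\<close> on functions on \<open>C\<close>, and \<open>f\<close> for its
  action on scalars; the hypotheses on them are what the valuation algebra structure
  supplies.\<close>

lemma additive_of_multiplicative_on_functions:
  fixes C :: "'c set"
    and f :: "'a::{comm_semiring_0, comm_monoid_mult} \<Rightarrow> 'b::{comm_semiring_0, comm_monoid_mult}"
    and H :: "('c \<Rightarrow> 'a) \<Rightarrow> 'c \<Rightarrow> 'b"
  assumes fin: "finite C" and card: "card C \<ge> 2"
    and nz: "no_mult_idempotent_zero_divisors TYPE('b)"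
    and f0: "f 0 = 0" and f1: "f 1 = 1"
    and mult: "\<And>g g' x. x \<in> C \<Longrightarrow> H (\<lambda>y. g y * g' y) x = H g x * H g' x"
    and const: "\<And>c x. x \<in> C \<Longrightarrow> H (\<lambda>_. c) x = f c"
    and sum: "\<And>g. f (sum g C) = sum (H g) C"
    and inj: "\<And>g g' x. \<forall>y\<in>C. H g y = H g' y \<Longrightarrow> x \<in> C \<Longrightarrow> g x = g' x"
  shows "f (a + b) = f a + f b"
\<comment> \<open>If \<open>0 = 1\<close>, the indicators are zero and the supports of their images
  may be empty, but then \<open>'a\<close> is trivial.\<close>
proof (cases "(0::'a) = 1")
  case True
  then have "x = 0" for x :: 'a
    by (metis mult_1 mult_zero_left)
  then have "a = 0" "b = 0" by blast+
  then show ?thesis by (simp add: f0)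
next
  case False
  define \<delta> where "\<delta> i = (\<lambda>x::'c. if x = i then 1 else (0::'a))" for i
  have disjoint: "i = j" if "x \<in> C" "H (\<delta> i) x \<noteq> 0" "H (\<delta> j) x \<noteq> 0" for i j x
  proof (rule ccontr)
    assume "i \<noteq> j"
    then have "(\<lambda>y. \<delta> i y * \<delta> j y) = (\<lambda>_. 0)"
      by (auto simp: \<delta>_def)
    then have "H (\<delta> i) x * H (\<delta> j) x = 0"
      using mult[OF that(1), of "\<delta> i" "\<delta> j"] const[OF that(1), of 0] f0 by simp
    moreover have "(\<lambda>y. \<delta> i y * \<delta> i y) = \<delta> i"
      by (auto simp: \<delta>_def)
    then have "H (\<delta> i) x * H (\<delta> i) x = H (\<delta> i) x"
      using mult[OF that(1), of "\<delta> i" "\<delta> i"] by simp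
    ultimately show False
      using nz that unfolding no_mult_idempotent_zero_divisors_def by blast
  qed
  have "\<exists>x\<in>C. H (\<delta> i) x \<noteq> 0" if "i \<in> C" for i
  proof (rule ccontr)
    assume "\<not> ?thesis"
    \<comment> \<open>An image vanishing on \<open>C\<close> agrees there with the image of the zero
      function, against \<open>inj\<close>.\<close>
    then have "\<forall>y\<in>C. H (\<delta> i) y = H (\<lambda>_. 0) y"
      by (simp add: const f0)
    from inj[OF this that] show False
      using False by (simp add: \<delta>_def)
  qed
  then obtain \<sigma> where \<sigma>: "\<And>i. i \<in> C \<Longrightarrow> \<sigma> i \<in> C" "\<And>i. i \<in> C \<Longrightarrow> H (\<delta> i) (\<sigma> i) \<noteq> 0"
    by metis
  have "inj_on \<sigma> C"
    \<comment> \<open>A common value of \<open>\<sigma>\<close> at \<open>i\<close> and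
      \<open>j\<close> would lie in both supports.\<close>
    by (rule inj_onI) (metis \<sigma> disjoint)
  then have bij: "bij_betw \<sigma> C C"
    using \<sigma>(1) fin by (simp add: bij_betw_def endo_inj_surj image_subsetI)
  have one: "H (\<delta> k) (\<sigma> k) = 1" if k: "k \<in> C" for k
  proof -
    \<comment> \<open>Since \<open>\<sigma>\<close> is onto, \<open>y\<close> is some
      \<open>\<sigma> j\<close> with \<open>j \<noteq> k\<close>, a point already in the support of
      \<open>H (\<delta> j)\<close>. The whole mass \<open>1\<close> thus sits at
      \<open>\<sigma> k\<close>.\<close>
    have zero: "H (\<delta> k) y = 0" if "y \<in> C" "y \<noteq> \<sigma> k" for y
    proof -
      obtain j where "j \<in> C" "y = \<sigma> j"
        using bij \<open>y \<in> C\<close> by (auto simp: bij_betw_def)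
      then show ?thesis using that \<sigma> disjoint by metis
    qed
    have "1 = f (sum (\<delta> k) C)"
      using k fin by (simp add: \<delta>_def f1)
    also have "\<dots> = (\<Sum>y\<in>C. H (\<delta> k) y)" by (rule sum)
    also have "\<dots> = H (\<delta> k) (\<sigma> k) + (\<Sum>y\<in>C - {\<sigma> k}. H (\<delta> k) y)"
      using fin \<sigma>(1)[OF k] by (rule sum.remove)
    also have "\<dots> = H (\<delta> k) (\<sigma> k)"
      using zero by (simp add: sum.neutral)
    finally show ?thesis by simp
  qed
  have H_\<sigma>: "H g (\<sigma> k) = f (g k)" if k: "k \<in> C" for g k
  proof -
    \<comment> \<open>Against \<open>\<delta> k\<close> the function \<open>g\<close> may be
      replaced by the constant \<open>g k\<close>, whose image is known; at
      \<open>\<sigma> k\<close> the other factor has image \<open>1\<close>.\<close>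
    have eq: "(\<lambda>y. g y * \<delta> k y) = (\<lambda>y. g k * \<delta> k y)"
      by (auto simp: \<delta>_def)
    have "H g (\<sigma> k) * H (\<delta> k) (\<sigma> k) = H (\<lambda>y. g k * \<delta> k y) (\<sigma> k)"
      unfolding eq[symmetric] by (rule mult[OF \<sigma>(1)[OF k], symmetric])
    also have "\<dots> = H (\<lambda>_. g k) (\<sigma> k) * H (\<delta> k) (\<sigma> k)"
      by (rule mult[OF \<sigma>(1)[OF k]])
    finally show ?thesis by (simp add: one[OF k] const \<sigma>(1)[OF k])
  qed
  have sum_f: "f (sum g C) = (\<Sum>k\<in>C. f (g k))" for g
  proof -
    have "f (sum g C) = (\<Sum>y\<in>C. H g y)" by (rule sum)
    also have "\<dots> = (\<Sum>k\<in>C. H g (\<sigma> k))"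
      using sum.reindex_bij_betw[OF bij] by metis
    finally show ?thesis by (simp add: H_\<sigma>)
  qed
  obtain i j where ij: "i \<in> C" "j \<in> C" "i \<noteq> j"
    using card fin by (metis card_le_Suc0_iff_eq not_less_eq_eq numeral_2_eq_2)
  define g where "g = (\<lambda>x. if x = i then a else if x = j then b else 0)"
  \<comment> \<open>The codomain is generic because the sum is taken once in \<open>'a\<close>, for
    \<open>g\<close>, and once in \<open>'b\<close>, for \<open>f\<close> after \<open>g\<close>,
    where the zeros come from \<open>f0\<close>.\<close>
  have two: "sum u C = u i + u j"
    if "\<And>x. x \<in> C - {i, j} \<Longrightarrow> u x = 0" for u :: "'c \<Rightarrow> 'd::comm_monoid_add"
  proof -
    have "sum u C = sum u {i, j}"
      using ij fin that by (intro sum.mono_neutral_right) auto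
    then show ?thesis using ij by simp
  qed
  have "f (a + b) = f (sum g C)"
    using ij by (subst two) (auto simp: g_def)
  also have "\<dots> = (\<Sum>k\<in>C. f (g k))" by (rule sum_f)
  also have "\<dots> = f a + f b"
    using ij by (subst two) (auto simp: g_def f0)
  finally show ?thesis .
qed

section \<open>Configurations and valuations\<close>

lemma restrict_configs: "x \<in> configs \<Omega> s \<Longrightarrow> restrict x s = x"
  by (simp add: configs_def PiE_restrict)

lemma restrict_empty_config: "restrict x {} = empty_config"
  by (auto simp: empty_config_def)

lemma finite_configs:
  assumes "finite s" "\<And>X. X \<in> s \<Longrightarrow> finite (\<Omega> X)"
  shows "finite (configs \<Omega> s)"
  using assms by (simp add: configs_def finite_PiE)

lemma card_configs_singleton: "card (configs \<Omega> {X}) = card (\<Omega> X)"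
  by (simp add: configs_def card_PiE)

text \<open>Extensionality gives this normal form, which lets arbitrary functions \<open>g\<close>
  represent valuations.\<close>

lemma valuation_eq:
  "\<phi> \<in> valuations r \<Omega> \<Longrightarrow> \<phi> = (val_dom \<phi>, restrict (val_fun \<phi>) (configs \<Omega> (val_dom \<phi>)))"
  by (cases \<phi>) (auto simp: valuations_def PiE_restrict)

lemma restrict_pair_eq_iff:
  "(s, restrict g C) = (s, restrict g' C) \<longleftrightarrow> (\<forall>x\<in>C. g x = g' x)"
  by (auto simp: fun_eq_iff restrict_def)

lemma restrict_valuation: "s \<subseteq> r \<Longrightarrow> (s, restrict g (configs \<Omega> s)) \<in> valuations r \<Omega>"
  by (simp add: valuations_def)

text \<open>The fibres of the projection to the full domain are singletons.\<close>

lemma marginalize_val_dom: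
  assumes "\<phi> \<in> valuations r \<Omega>"
  shows "marginalize \<Omega> \<phi> (val_dom \<phi>) = \<phi>"
proof -
  have "{z \<in> configs \<Omega> (val_dom \<phi>). restrict z (val_dom \<phi>) = x} = {x}"
    if "x \<in> configs \<Omega> (val_dom \<phi>)" for x
    using that by (auto simp: restrict_configs)
  then have "marginalize \<Omega> \<phi> (val_dom \<phi>) =
      (val_dom \<phi>, restrict (val_fun \<phi>) (configs \<Omega> (val_dom \<phi>)))"
    by (auto simp: marginalize_def)
  then show ?thesis using valuation_eq[OF assms] by metis
qed

text \<open>All configurations project to \<open>empty_config\<close>, so the only fibre is the
  whole set and its sum is the total mass.\<close>

lemma marginalize_empty:
  "marginalize \<Omega> (s, restrict g (configs \<Omega> s)) {} = scalar_val \<Omega> (sum g (configs \<Omega> s))"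
proof -
  have "{z \<in> configs \<Omega> s. restrict z {} = empty_config} = configs \<Omega> s"
    by (simp add: restrict_empty_config)
  then show ?thesis
    by (auto simp: marginalize_def scalar_val_def const_val_def configs_empty)
qed

lemma combine_same_domain:
  "combine \<Omega> (s, restrict g (configs \<Omega> s)) (s, restrict g' (configs \<Omega> s)) =
     (s, restrict (\<lambda>x. g x * g' x) (configs \<Omega> s))"
  by (auto simp: combine_def restrict_configs)

text \<open>This determines the image of a constant valuation under \<open>h\<close>, since the
  images of both factors are known.\<close>

lemma combine_scalar_neutral:
  "combine \<Omega> (scalar_val \<Omega> a) (neutral_val \<Omega> s) = const_val \<Omega> s a"
  by (auto simp: combine_def scalar_val_def neutral_val_def const_val_def
      configs_empty restrict_empty_config restrict_configs intro!: restrict_ext)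

lemma combine_scalar:
  "combine \<Omega> (scalar_val \<Omega> a) (scalar_val \<Omega> b) = scalar_val \<Omega> (a * b)"
  by (simp add: scalar_val_def const_val_def combine_same_domain)

lemma scalar_val_eq_iff: "scalar_val \<Omega> a = scalar_val \<Omega> b \<longleftrightarrow> a = b"
proof
  assume "scalar_val \<Omega> a = scalar_val \<Omega> b"
  then have "val_fun (scalar_val \<Omega> a) empty_config = val_fun (scalar_val \<Omega> b) empty_config"
    by simp
  then show "a = b" by (simp add: scalar_val_def const_val_def configs_empty)
qed simp

lemma scalar_val_in_valuations: "scalar_val \<Omega> a \<in> valuations r \<Omega>"
  by (simp add: scalar_val_def const_val_def restrict_valuation)

lemma empty_domain_scalar:
  assumes "\<phi> \<in> valuations r \<Omega>" "val_dom \<phi> = {}"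
  shows "\<phi> = scalar_val \<Omega> (val_fun \<phi> empty_config)"
proof -
  have "restrict (val_fun \<phi>) {empty_config} = restrict (\<lambda>_. val_fun \<phi> empty_config) {empty_config}"
    by (rule restrict_ext) simp
  then have "scalar_val \<Omega> (val_fun \<phi> empty_config) =
      (val_dom \<phi>, restrict (val_fun \<phi>) (configs \<Omega> (val_dom \<phi>)))"
    by (simp add: assms(2) scalar_val_def const_val_def configs_empty)
  then show ?thesis
    using valuation_eq[OF assms(1)] by metis
qed

text \<open>Apply \<open>h\<close> to \<open>\<phi>\<close> written as its own marginal: the result
  is a marginal to \<open>val_dom \<phi>\<close> and so has that domain.\<close>

lemma valuation_algebra_hom_val_dom:
  assumes "valuation_algebra_hom r \<Omega> h" "\<phi> \<in> valuations r \<Omega>"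
  shows "val_dom (h \<phi>) = val_dom \<phi>"
proof -
  have "h (marginalize \<Omega> \<phi> (val_dom \<phi>)) = marginalize \<Omega> (h \<phi>) (val_dom \<phi>)"
    using assms by (auto simp: valuation_algebra_hom_def)
  then have "h \<phi> = marginalize \<Omega> (h \<phi>) (val_dom \<phi>)"
    by (simp add: marginalize_val_dom[OF assms(2)])
  from arg_cong[OF this, of fst] show ?thesis by (simp add: marginalize_def)
qed

section \<open>The induced semiring isomorphism\<close>

theorem theorem2:
  fixes r :: "'v set"
    and \<Omega> :: "'v \<Rightarrow> 'x set"
    and h :: "('v, 'x, 'a::{comm_semiring_0, comm_monoid_mult}) valuation \<Rightarrow>
              ('v, 'x, 'b::{comm_semiring_0, comm_monoid_mult}) valuation"
  assumes "finite r" and "r \<noteq> {}"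
    and "\<And>X. X \<in> r \<Longrightarrow> finite (\<Omega> X)"
    and "\<exists>X\<in>r. card (\<Omega> X) \<ge> 2"
    and "additively_idempotent TYPE('a)"
    and "additively_idempotent TYPE('b)"
    and "no_mult_idempotent_zero_divisors TYPE('a)"
    and "no_mult_idempotent_zero_divisors TYPE('b)"
    and "valuation_algebra_iso r \<Omega> h"
  shows "semiring_iso (\<lambda>a::'a. val_fun (h (scalar_val \<Omega> a)) empty_config)"
proof -
  define f where "f a = val_fun (h (scalar_val \<Omega> a)) empty_config" for a
  have hom: "valuation_algebra_hom r \<Omega> h" and bij: "bij_betw h (valuations r \<Omega>) (valuations r \<Omega>)"
    using assms(9) by (auto simp: valuation_algebra_iso_def)
  have h_in: "\<And>\<phi>. \<phi> \<in> valuations r \<Omega> \<Longrightarrow> h \<phi> \<in> valuations r \<Omega>"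
    and h_comb: "\<And>\<phi> \<psi>. \<phi> \<in> valuations r \<Omega> \<Longrightarrow> \<psi> \<in> valuations r \<Omega> \<Longrightarrow>
        h (combine \<Omega> \<phi> \<psi>) = combine \<Omega> (h \<phi>) (h \<psi>)"
    and h_marg: "\<And>\<phi> t. \<phi> \<in> valuations r \<Omega> \<Longrightarrow> t \<subseteq> val_dom \<phi> \<Longrightarrow>
        h (marginalize \<Omega> \<phi> t) = marginalize \<Omega> (h \<phi>) t"
    and h_neutral: "\<And>s. s \<subseteq> r \<Longrightarrow> h (neutral_val \<Omega> s) = neutral_val \<Omega> s"
    using hom by (auto simp: valuation_algebra_hom_def)
  note h_dom = valuation_algebra_hom_val_dom[OF hom]
  have h_inj: "\<phi> = \<psi>" if "h \<phi> = h \<psi>" "\<phi> \<in> valuations r \<Omega>" "\<psi> \<in> valuations r \<Omega>" for \<phi> \<psi>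
    using bij that by (auto simp: bij_betw_def dest: inj_onD)
  \<comment> \<open>Domain preservation makes the image of a scalar a scalar, so identities for
    \<open>h\<close> on scalars become identities for \<open>f\<close>.\<close>
  have h_scalar: "h (scalar_val \<Omega> a) = scalar_val \<Omega> (f a)" for a
    unfolding f_def
    by (rule empty_domain_scalar[OF h_in[OF scalar_val_in_valuations]])
      (simp add: h_dom[OF scalar_val_in_valuations], simp add: scalar_val_def const_val_def)

  have f_mult: "f (a * b) = f a * f b" for a b
    using h_comb[OF scalar_val_in_valuations scalar_val_in_valuations, of a b]
    by (simp add: combine_scalar h_scalar scalar_val_eq_iff)
  have "scalar_val \<Omega> (f 1) = scalar_val \<Omega> 1"
    using h_neutral[of "{}"] h_scalar[of 1] by (simp add: neutral_val_def scalar_val_def)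
  then have f1: "f 1 = 1" by (simp add: scalar_val_eq_iff)
  have inj: "inj f"
    by (rule injI) (metis h_scalar h_inj scalar_val_in_valuations scalar_val_eq_iff)
  have surj: "\<exists>a. f a = b" for b
  proof -
    have "scalar_val \<Omega> b \<in> h ` valuations r \<Omega>"
      using bij scalar_val_in_valuations by (auto simp: bij_betw_def)
    then obtain \<phi> where \<phi>: "\<phi> \<in> valuations r \<Omega>" "h \<phi> = scalar_val \<Omega> b" by auto
    then have "val_dom \<phi> = {}"
      using h_dom[OF \<phi>(1)] by (simp add: scalar_val_def const_val_def)
    then show ?thesis
      using empty_domain_scalar[OF \<phi>(1)] \<phi>(2) h_scalar by (metis scalar_val_eq_iff)
  qed
  \<comment> \<open>Preservation of zero follows from a preimage \<open>c\<close> of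
    \<open>0\<close>: \<open>f 0 = f (0 * c) = f 0 * f c = 0\<close>.\<close>
  obtain c where "f c = 0" using surj by blast
  then have f0: "f 0 = 0" using f_mult[of 0 c] by simp

  \<comment> \<open>Over \<open>{X}\<close> there are at least two configurations, enough room for
    two summands.\<close>
  obtain X where X: "X \<in> r" "card (\<Omega> X) \<ge> 2" using assms(4) by blast
  define C where "C = configs \<Omega> {X}"
  define H where "H g = val_fun (h ({X}, restrict g C))" for g
  have in_val: "({X}, restrict g C) \<in> valuations r \<Omega>" for g :: "_ \<Rightarrow> 'c"
    using X(1) by (simp add: C_def restrict_valuation)
  have h_eq: "h ({X}, restrict g C) = ({X}, restrict (H g) C)" for g
    using valuation_eq[OF h_in[OF in_val, of g]]
    unfolding h_dom[OF in_val] fst_conv H_def C_def[symmetric] .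
  have f_add: "f (a + b) = f a + f b" for a b
  proof (rule additive_of_multiplicative_on_functions[where C = C and H = H])
    show "finite C" unfolding C_def using X(1) assms(3) by (intro finite_configs) auto
    show "card C \<ge> 2" using X(2) by (simp add: C_def card_configs_singleton)
    show "H (\<lambda>y. g y * g' y) x = H g x * H g' x" if "x \<in> C" for g g' x
    proof -
      have "({X}, restrict (H (\<lambda>y. g y * g' y)) C) = ({X}, restrict (\<lambda>y. H g y * H g' y) C)"
        using h_comb[OF in_val in_val, of g g']
        by (simp add: h_eq combine_same_domain[where s = "{X}" and \<Omega> = \<Omega>, folded C_def])
      then show ?thesis using that unfolding restrict_pair_eq_iff by blast
    qed
    show "H (\<lambda>_. c) x = f c" if "x \<in> C" for c x
    proof -
      have "neutral_val \<Omega> {X} \<in> valuations r \<Omega>"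
        using in_val by (simp add: neutral_val_def const_val_def C_def)
      then have "h (const_val \<Omega> {X} c) = const_val \<Omega> {X} (f c)"
        using h_comb[OF scalar_val_in_valuations, of "neutral_val \<Omega> {X}" c] X(1)
        by (simp add: combine_scalar_neutral h_scalar h_neutral)
      then have "({X}, restrict (H (\<lambda>_. c)) C) = ({X}, restrict (\<lambda>_. f c) C)"
        by (simp add: const_val_def h_eq flip: C_def)
      then show ?thesis using that unfolding restrict_pair_eq_iff by blast
    qed
    \<comment> \<open>Compare total masses: marginalization to \<open>{}\<close> commutes with
      \<open>h\<close>.\<close>
    show "f (sum g C) = sum (H g) C" for g
      using h_marg[OF in_val, of "{}" g]
      by (simp add: h_eq marginalize_empty[where s = "{X}" and \<Omega> = \<Omega>, folded C_def]
          h_scalar scalar_val_eq_iff)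
    show "g x = g' x" if "\<forall>y\<in>C. H g y = H g' y" "x \<in> C" for g g' x
    proof -
      have "restrict (H g) C = restrict (H g') C"
        using that(1) by (intro restrict_ext) auto
      then have "h ({X}, restrict g C) = h ({X}, restrict g' C)" by (simp add: h_eq)
      from h_inj[OF this in_val in_val] show ?thesis
        using that(2) unfolding restrict_pair_eq_iff by blast
    qed
  qed (use assms(8) f0 f1 in auto)

  have "semiring_iso f"
    using f_add f_mult f0 f1 inj surj
    by (auto simp: semiring_iso_def semiring_hom_def bij_def surj_def) metis
  then show ?thesis by (simp add: f_def[abs_def])
qed

end
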